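(* Assume (A1)–(A5) of the context hold, and let $(\bar u(\cdot),\bar X(\cdot))$ be an optimal pair of the problem OCSC. For every integer $n>0$ and every partition $0=t_0<t_1<\cdots<t_n=T$, let $(\tilde u^n(\cdot),\tilde X^n(\cdot))$ denote an optimal pair of the discrete problem associated with $(t_0,\dots,t_n)$. Then OCSC has a near-optimal control problem given by discrete state constraints. That is, there is a function $\Theta$ on $(0,1)$ with $\Theta(\delta)\to 0$ as $\delta\to 0$ such that for every $0<\delta<1$ there exist an integer $n>0$ and a partition $0=t_0<t_1<\cdots<t_n=T$ with $$\left|J(\tilde u^n(\cdot))-J(\bar u(\cdot))\right|\le \Theta(\delta).$$
   Context: Let $T>0$, $x_0\in\mathbb{R}$, let $U\subset\mathbb{R}$ be connected, and let $\mathbb{S}=[0,+\infty)$. Let $b:\mathbb{R}\times U\to\mathbb{R}$, $f:\mathbb{R}\times U\to\mathbb{R}$, $\Psi:\mathbb{R}\to\mathbb{R}$ be uniformly continuous. For $0\le t\le s\le T$ write $\mathcal{U}[t,s]=L^2(t,s;U)$. For $u(\cdot)\in\mathcal{U}[0,T]$, $X^u$ denotes the solution of $\dot X^u(s)=b(X^u(s),u(s))$, $s\in(0,T]$, $X^u(0)=x_0$. The cost functional is $$J(u(\cdot))=\int_0^T f(X^u(t),u(t))\,dt+\Psi(X^u(T)).$$ Problem OCSC: minimize $J(u(\cdot))$ over $u(\cdot)\in\mathcal{U}[0,T]$ subject to $X^u(t)\in\mathbb{S}$ for all $0\le t\le T$. Discrete problem associated with a partition $0=t_0<t_1<\cdots<t_n=T$: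 minimize $J(u(\cdot))$ over $u(\cdot)\in\mathcal{U}[0,T]$ subject to $X^u(t_i)\in\mathbb{S}$ for $i=0,1,\dots,n$. An optimal pair of either problem is a pair (minimizing control, corresponding state trajectory). Assumptions: (A1) There is $c>0$ with $|b(x_1,u)-b(x_2,u)|\le c|x_1-x_2|$ for all $(x_1,u),(x_2,u)\in\mathbb{R}\times U$. (A2) There is $c>0$ with $\sup_{u\in\mathcal{U}[0,T]}\int_0^T|b(0,u(t))|^2dt\le c$. (A3) $b,f,\Psi$ are differentiable in $x$, and their derivatives in $x$ are continuous with respect to $(x,u)$. (A4) There are $c_1,c_2>0$ with $c_1|u_1-u_2|\le|b(x,u_1)-b(x,u_2)|\le c_2|u_1-u_2|$ for all $(x,u_1),(x,u_2)\in\mathbb{R}\times U$. (A5) For any $0\le t\le s\le T$, $u(\cdot)\in\mathcal{U}[0,T]$ and $y\in\partial\mathbb{S}$ (the boundary of $\mathbb{S}$), there exist two controls $u_1(\cdot),u_2(\cdot)\in\mathcal{U}[t,s]$ such that the solutions of the state equation on $[t,s]$ with $X^{u_1}(t)=X^{u_2}(t)=y$ satisfy $X^{u_1}(s)\le y\le X^{u_2}(s)$. *)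

theory Defs
  imports "HOL-Analysis.Analysis"
begin

text \<open>The state constraint set \<open>\<S>\<close> of the problem.\<close>

definition state_set :: "real set" where
  "state_set = {0..}"

text \<open>The space \<open>L\<^sup>2(t,s;U)\<close>, with a control represented by a Lebesgue measurable function that is
  \<open>U\<close>-valued everywhere on \<open>[t,s]\<close>; values outside \<open>[t,s]\<close> are irrelevant.\<close>

definition controls :: "real set \<Rightarrow> real \<Rightarrow> real \<Rightarrow> (real \<Rightarrow> real) set" where
  "controls U t s = {u. u \<in> borel_measurable (lebesgue_on {t..s})
     \<and> (\<forall>r\<in>{t..s}. u r \<in> U)
     \<and> integrable (lebesgue_on {t..s}) (\<lambda>r. (u r)\<^sup>2)}"

text \<open>\<open>X\<close> solves \<open>X' = b(X,u)\<close> on \<open>[t,s]\<close> with \<open>X(t) = y\<close>. As \<open>u\<close> is only measurable, this is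
  meant in the sense of Caratheodory, i.e. as an integral equation.\<close>

definition is_state ::
  "(real \<Rightarrow> real \<Rightarrow> real) \<Rightarrow> real \<Rightarrow> real \<Rightarrow> real \<Rightarrow> (real \<Rightarrow> real) \<Rightarrow> (real \<Rightarrow> real) \<Rightarrow> bool" where
  "is_state b t s y u X \<longleftrightarrow>
     continuous_on {t..s} X
     \<and> integrable (lebesgue_on {t..s}) (\<lambda>\<tau>. b (X \<tau>) (u \<tau>))
     \<and> (\<forall>r\<in>{t..s}. X r = y + (\<integral>\<tau>. b (X \<tau>) (u \<tau>) \<partial>lebesgue_on {t..r}))"

text \<open>The trajectory \<open>X\<^sup>u\<close>. If \<open>b\<close> is Lipschitz in the state, its values on \<open>[0,T]\<close> do not depend
  on the choice, which only concerns values outside \<open>[0,T]\<close>.\<close>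

definition state ::
  "(real \<Rightarrow> real \<Rightarrow> real) \<Rightarrow> real \<Rightarrow> real \<Rightarrow> (real \<Rightarrow> real) \<Rightarrow> real \<Rightarrow> real" where
  "state b T x0 u = (SOME X. is_state b 0 T x0 u X)"

definition cost ::
  "(real \<Rightarrow> real \<Rightarrow> real) \<Rightarrow> (real \<Rightarrow> real \<Rightarrow> real) \<Rightarrow> (real \<Rightarrow> real) \<Rightarrow> real \<Rightarrow> real
    \<Rightarrow> (real \<Rightarrow> real) \<Rightarrow> real" where
  "cost b f \<Psi> T x0 u =
     (\<integral>t. f (state b T x0 u t) (u t) \<partial>lebesgue_on {0..T}) + \<Psi> (state b T x0 u T)"

text \<open>\<open>D\<close> is the set of times at which the state constraint is imposed.\<close>

definition admissible_pair ::
  "(real \<Rightarrow> real \<Rightarrow> real) \<Rightarrow> real set \<Rightarrow> real \<Rightarrow> real \<Rightarrow> real set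
    \<Rightarrow> (real \<Rightarrow> real) \<Rightarrow> (real \<Rightarrow> real) \<Rightarrow> bool" where
  "admissible_pair b U T x0 D u X \<longleftrightarrow>
     u \<in> controls U 0 T \<and> is_state b 0 T x0 u X \<and> (\<forall>t\<in>D. X t \<in> state_set)"

definition optimal_pair ::
  "(real \<Rightarrow> real \<Rightarrow> real) \<Rightarrow> (real \<Rightarrow> real \<Rightarrow> real) \<Rightarrow> (real \<Rightarrow> real) \<Rightarrow> real set \<Rightarrow> real \<Rightarrow> real
    \<Rightarrow> real set \<Rightarrow> (real \<Rightarrow> real) \<Rightarrow> (real \<Rightarrow> real) \<Rightarrow> bool" where
  "optimal_pair b f \<Psi> U T x0 D u X \<longleftrightarrow>
     admissible_pair b U T x0 D u X
     \<and> (\<forall>v Y. admissible_pair b U T x0 D v Y \<longrightarrow> cost b f \<Psi> T x0 u \<le> cost b f \<Psi> T x0 v)"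

definition optimal_pair_OCSC ::
  "(real \<Rightarrow> real \<Rightarrow> real) \<Rightarrow> (real \<Rightarrow> real \<Rightarrow> real) \<Rightarrow> (real \<Rightarrow> real) \<Rightarrow> real set \<Rightarrow> real \<Rightarrow> real
    \<Rightarrow> (real \<Rightarrow> real) \<Rightarrow> (real \<Rightarrow> real) \<Rightarrow> bool" where
  "optimal_pair_OCSC b f \<Psi> U T x0 u X \<longleftrightarrow> optimal_pair b f \<Psi> U T x0 {0..T} u X"

text \<open>A partition \<open>0 = p 0 < \<dots> < p n = T\<close>; the values \<open>p i\<close> for \<open>i > n\<close> are irrelevant.\<close>

definition is_partition :: "real \<Rightarrow> nat \<Rightarrow> (nat \<Rightarrow> real) \<Rightarrow> bool" where
  "is_partition T n p \<longleftrightarrow> p 0 = 0 \<and> p n = T \<and> (\<forall>i<n. p i < p (Suc i))"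

definition optimal_pair_discrete ::
  "(real \<Rightarrow> real \<Rightarrow> real) \<Rightarrow> (real \<Rightarrow> real \<Rightarrow> real) \<Rightarrow> (real \<Rightarrow> real) \<Rightarrow> real set \<Rightarrow> real \<Rightarrow> real
    \<Rightarrow> nat \<Rightarrow> (nat \<Rightarrow> real) \<Rightarrow> (real \<Rightarrow> real) \<Rightarrow> (real \<Rightarrow> real) \<Rightarrow> bool" where
  "optimal_pair_discrete b f \<Psi> U T x0 n p u X \<longleftrightarrow> optimal_pair b f \<Psi> U T x0 (p ` {0..n}) u X"

end

theory Submission
  imports Defs
begin

text \<open>
  By (A2) and (A4), \<open>b(0,\<cdot>)\<close> and \<open>U\<close> are bounded, so all trajectories are uniformly bounded and
  uniformly Lipschitz. Discrete constraints are weaker, so the discrete optimum is at most the optimum of OCSC; for the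
  reverse estimate a control feasible at the partition points is turned into one feasible at all times,
  at small cost.

  If \<open>b(0,\<cdot>) \<le> 0\<close> on \<open>U\<close>, a trajectory that becomes negative stays negative, so the constraint at
  \<open>T\<close> alone already implies feasibility. Otherwise choose \<open>w\<close> with \<open>b(0,w) > 0\<close> and replace \<open>u\<close> by \<open>w\<close> on
  an initial part, of measure at most \<open>\<epsilon>\<close>, of the set where \<open>b(0,u) \<le> b(0,w)/2\<close>. During the modification
  the drift at the boundary is positive, so the new trajectory \<open>Y\<close> is nonnegative; if the whole
  measure \<open>\<epsilon>\<close> has been used up, \<open>Y\<close> lies above the old trajectory \<open>X\<close> by an amount proportional
  to \<open>\<epsilon>\<close>, which a sufficiently fine partition makes larger than the violation of the constraint by
  \<open>X\<close>. As \<open>Y - X = O(\<epsilon>)\<close> uniformly, the costs are close.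
\<close>

section \<open>Differential inequalities\<close>

text \<open>Gronwall's inequality in integral form: multiplied by the integrating factor
  \<open>exp (- c * (r - a))\<close>, the majorant \<open>M + c * P r\<close> becomes nonincreasing,
  since its derivative carries the factor \<open>E r - (M + c * P r) \<le> 0\<close>.\<close>

lemma integral_gronwall:
  fixes E :: "real \<Rightarrow> real"
  assumes cont: "continuous_on {a..b} E" and c: "0 \<le> c"
    and le: "\<And>t. t \<in> {a..b} \<Longrightarrow> E t \<le> M + c * integral {a..t} E"
    and t: "t \<in> {a..b}"
  shows "E t \<le> M * exp (c * (t - a))"
proof -
  define P where "P r = integral {a..r} E" for r
  define Q where "Q r = exp (- c * (r - a)) * (M + c * P r)" for r
  have P': "(P has_real_derivative E r) (at r within {a..b})" if "r \<in> {a..b}" for r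
    unfolding P_def using integral_has_real_derivative[OF cont that] .
  have "Q t \<le> Q a"
  proof (rule DERIV_nonpos_imp_decreasing_open[of a t Q])
    show "a \<le> t" using t by simp
  next
    fix r assume r: "a < r" "r < t"
    have "(P has_real_derivative E r) (at r)"
      using P'[of r] r t at_within_Icc_at[of a r b] by simp
    then have "(Q has_real_derivative exp (- c * (r - a)) * (c * (E r - (M + c * P r)))) (at r)"
      unfolding Q_def by (auto intro!: derivative_eq_intros simp: algebra_simps)
    moreover have "exp (- c * (r - a)) * (c * (E r - (M + c * P r))) \<le> 0"
      using le[of r] r t c by (simp add: P_def mult_nonneg_nonpos)
    ultimately show "\<exists>y. (Q has_real_derivative y) (at r) \<and> y \<le> 0" by blast
  next
    have "continuous_on {a..b} P"
      using P' DERIV_continuous_on by blast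
    then have "continuous_on {a..t} P"
      by (rule continuous_on_subset) (use t in auto)
    then show "continuous_on {a..t} Q"
      unfolding Q_def by (intro continuous_intros)
  qed
  have "Q a = M" by (simp add: Q_def P_def)
  have "E t \<le> M + c * P t" using le[OF t] by (simp add: P_def)
  also have "\<dots> = exp (c * (t - a)) * Q t"
    by (simp add: Q_def flip: exp_add mult.assoc)
  also have "\<dots> \<le> exp (c * (t - a)) * M"
    using \<open>Q t \<le> Q a\<close> \<open>Q a = M\<close> by simp
  finally show ?thesis by (simp add: mult.commute)
qed

text \<open>Here \<open>g\<close> plays the role of the derivative of \<open>D\<close>; the integral
  form suits trajectories driven by merely measurable controls. If \<open>D\<close> were negative at
  \<open>t\<close>, Gronwall applied to \<open>- D\<close> from the last zero before
  \<open>t\<close> would give a contradiction.\<close>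

lemma nonneg_if_derivative_ge:
  fixes D g :: "real \<Rightarrow> real"
  assumes g: "g integrable_on {a..b}"
    and D: "\<And>r. r \<in> {a..b} \<Longrightarrow> D r = D a + integral {a..r} g"
    and c: "0 \<le> c" and ge: "\<And>r. r \<in> {a..b} \<Longrightarrow> - c * \<bar>D r\<bar> \<le> g r"
    and D0: "0 \<le> D a" and t: "t \<in> {a..b}"
  shows "0 \<le> D t"
proof (rule ccontr)
  assume neg: "\<not> 0 \<le> D t"
  have cont: "continuous_on {a..b} D"
    using indefinite_integral_continuous_1[OF g]
    by (subst continuous_on_cong[OF refl D]) (auto intro!: continuous_intros)
  \<comment> \<open>The last time in \<open>[a,t]\<close> with \<open>D \<ge> 0\<close>: it exists
    because \<open>Z\<close> is compact and contains \<open>a\<close>, and the intermediate value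
    theorem excludes \<open>D s > 0\<close>.\<close>
  obtain s where s: "s \<in> {a..t}" "D s = 0" "\<And>r. r \<in> {s<..t} \<Longrightarrow> D r < 0"
  proof -
    define Z where "Z = {r \<in> {a..t}. D r \<in> {0..}}"
    have ct: "continuous_on {a..t} D"
      using cont by (rule continuous_on_subset) (use t in auto)
    have "closed Z"
      unfolding Z_def
      using continuous_on_closed_vimage[of "{a..t}" D] ct
      by (metis (no_types) closed_atLeast closed_atLeastAtMost continuous_closed_preimage Collect_conj_eq
          Int_def vimage_def Collect_mem_eq)
    moreover have "bounded Z" by (rule bounded_subset[of "{a..t}"]) (auto simp: Z_def)
    moreover have "a \<in> Z" using D0 t by (auto simp: Z_def)
    ultimately obtain s where s: "s \<in> Z" "\<And>r. r \<in> Z \<Longrightarrow> r \<le> s"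
      using compact_attains_sup[of Z] compact_eq_bounded_closed by blast
    have neg': "D r < 0" if "r \<in> {s<..t}" for r
      using s(1) s(2)[of r] that by (force simp: Z_def)
    have "s < t" using s(1) neg by (cases "s = t") (auto simp: Z_def)
    have "D s \<le> 0"
    proof (rule ccontr)
      assume "\<not> D s \<le> 0"
      moreover have "continuous_on {s..t} D"
        using ct by (rule continuous_on_subset) (use s in \<open>auto simp: Z_def\<close>)
      ultimately obtain r where "s \<le> r" "r \<le> t" "D r = 0"
        using IVT2'[of D t 0 s] neg \<open>s < t\<close> by auto
      with neg'[of r] \<open>\<not> D s \<le> 0\<close> show False by (cases "r = s") auto
    qed
    with s(1) neg' that[of s] show thesis by (auto simp: Z_def)
  qed
  have int_st: "g integrable_on {s..r}" if "r \<in> {s..t}" for r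
    by (rule integrable_on_subinterval[OF g]) (use s t that in auto)
  have cont_st: "continuous_on {s..t} (\<lambda>r. - D r)"
    by (intro continuous_intros continuous_on_subset[OF cont]) (use s t in auto)
  \<comment> \<open>On \<open>[s,t]\<close> the bound \<open>- c * \<bar>D\<bar>\<close> equals
    \<open>c * D\<close>, so integrating it gives the Gronwall hypothesis for \<open>- D\<close>
    with \<open>M = 0\<close>.\<close>
  have "- D r \<le> 0 + c * integral {s..r} (\<lambda>r. - D r)" if r: "r \<in> {s..t}" for r
  proof -
    have "integral {a..s} g + integral {s..r} g = integral {a..r} g"
      by (rule Henstock_Kurzweil_Integration.integral_combine)
        (use s r t in \<open>auto intro: integrable_on_subinterval[OF g]\<close>)
    then have "D r = integral {s..r} g"
      using D[of r] D[of s] s t r by auto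
    moreover have "integral {s..r} (\<lambda>r. c * D r) \<le> integral {s..r} g"
    proof (rule integral_le)
      show "(\<lambda>r. c * D r) integrable_on {s..r}"
        by (intro integrable_continuous_interval continuous_intros continuous_on_subset[OF cont])
          (use s t r in auto)
      show "c * D q \<le> g q" if "q \<in> {s..r}" for q
      proof -
        have "D q \<le> 0"
          using s(2) s(3)[of q] that r by (cases "q = s") auto
        then show ?thesis using ge[of q] that r s t by auto
      qed
    qed (use int_st r in auto)
    ultimately show ?thesis by simp
  qed
  from integral_gronwall[OF cont_st c this, of t] neg s t show False by auto
qed

text \<open>Subtract the solution \<open>e\<close> of \<open>e' = - c * e\<close> with
  \<open>e a = m\<close>. The difference again satisfies the hypotheses of
  \<open>nonneg_if_derivative_ge\<close>, because
  \<open>\<bar>D\<bar> \<le> \<bar>D - e\<bar> + e\<close>.\<close>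

lemma exp_lower_bound_if_derivative_ge:
  fixes D g :: "real \<Rightarrow> real"
  assumes g: "g integrable_on {a..b}"
    and D: "\<And>r. r \<in> {a..b} \<Longrightarrow> D r = D a + integral {a..r} g"
    and c: "0 \<le> c" and ge: "\<And>r. r \<in> {a..b} \<Longrightarrow> - c * \<bar>D r\<bar> \<le> g r"
    and m: "0 \<le> m" "m \<le> D a" and t: "t \<in> {a..b}"
  shows "m * exp (- c * (t - a)) \<le> D t"
proof -
  define e where "e r = m * exp (- c * (r - a))" for r
  have e': "((\<lambda>r. - c * e r) has_integral (e r - e a)) {a..r}" if "a \<le> r" for r
    unfolding e_def
    by (rule fundamental_theorem_of_calculus[OF that])
      (auto intro!: derivative_eq_intros simp flip: has_real_derivative_iff_has_vector_derivative)
  have e_pos: "0 \<le> e r" for r using m by (simp add: e_def)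
  have "0 \<le> D t - e t"
  proof (rule nonneg_if_derivative_ge[where D="\<lambda>r. D r - e r" and g="\<lambda>r. g r - - c * e r" and a=a and b=b and c=c])
    show "(\<lambda>r. g r - - c * e r) integrable_on {a..b}"
      by (rule integrable_diff[OF g has_integral_integrable[OF e'[of b]]]) (use t in auto)
    show "D r - e r = D a - e a + integral {a..r} (\<lambda>r. g r - - c * e r)" if r: "r \<in> {a..b}" for r
    proof -
      have "integral {a..r} (\<lambda>r. g r - - c * e r) = integral {a..r} g - integral {a..r} (\<lambda>r. - c * e r)"
        by (rule integral_diff)
          (use r in \<open>auto intro: integrable_on_subinterval[OF g] has_integral_integrable[OF e'[of r], simplified]\<close>)
      then show ?thesis
        using D[OF r] integral_unique[OF e'[of r]] r by simp
    qed
    show "- c * \<bar>D r - e r\<bar> \<le> g r - - c * e r" if r: "r \<in> {a..b}" for r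
    proof -
      have "\<bar>D r\<bar> \<le> \<bar>D r - e r\<bar> + e r" using e_pos[of r] by linarith
      from mult_left_mono[OF this c] ge[OF r] show ?thesis by (simp add: algebra_simps)
    qed
    show "0 \<le> D a - e a" using m by (simp add: e_def)
  qed (use c t in auto)
  then show ?thesis by (simp add: e_def)
qed

section \<open>Trajectories of the control system\<close>

lemma bounded_measurable_absolutely_integrable:
  fixes g :: "real \<Rightarrow> real"
  assumes "g \<in> borel_measurable (lebesgue_on {a..b})" "\<And>t. t \<in> {a..b} \<Longrightarrow> \<bar>g t\<bar> \<le> C"
  shows "g absolutely_integrable_on {a..b}"
  by (rule measurable_bounded_by_integrable_imp_absolutely_integrable[where g="\<lambda>_. C"])
    (use assms in auto)

lemma measurable_running:
  fixes g :: "real \<Rightarrow> real \<Rightarrow> real"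
  assumes g: "continuous_on (UNIV \<times> U) (\<lambda>(x, u). g x u)"
    and u: "u \<in> controls U a b" and X: "continuous_on {a..b} X"
  shows "(\<lambda>t. g (X t) (u t)) \<in> borel_measurable (lebesgue_on {a..b})"
proof -
  have [measurable]: "X \<in> borel_measurable (lebesgue_on {a..b})"
    by (rule continuous_imp_measurable_on_sets_lebesgue[OF X]) auto
  have [measurable]: "u \<in> borel_measurable (lebesgue_on {a..b})"
    using u by (simp add: controls_def)
  \<comment> \<open>Continuity of \<open>g\<close> is given only on \<open>UNIV \<times> U\<close>,
    so the pair is viewed as a map into the Borel space restricted to that set.\<close>
  have "(\<lambda>t. (X t, u t)) \<in> measurable (lebesgue_on {a..b}) (restrict_space borel (UNIV \<times> U))"
  proof (rule measurable_restrict_space2)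
    show "(\<lambda>t. (X t, u t)) \<in> space (lebesgue_on {a..b}) \<rightarrow> UNIV \<times> U"
      using u by (auto simp: controls_def)
  qed simp
  from measurable_compose[OF this borel_measurable_continuous_on_restrict[OF g]]
  show ?thesis by simp
qed

text \<open>The pointwise bound \<open>B\<close> is what (A2) yields when tested with constant
  controls. With the Lipschitz condition it gives linear growth of \<open>b\<close>, uniformly over
  \<open>U\<close>.\<close>

locale control_system =
  fixes b :: "real \<Rightarrow> real \<Rightarrow> real" and U :: "real set" and c B :: real
  assumes b_cont: "continuous_on (UNIV \<times> U) (\<lambda>(x, u). b x u)"
    and c_pos: "0 < c"
    and b_lipschitz: "u \<in> U \<Longrightarrow> \<bar>b x u - b y u\<bar> \<le> c * \<bar>x - y\<bar>"
    and b_bound: "u \<in> U \<Longrightarrow> \<bar>b 0 u\<bar> \<le> B"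
begin

lemma b_growth: "u \<in> U \<Longrightarrow> \<bar>b x u\<bar> \<le> B + c * \<bar>x\<bar>"
  using b_lipschitz[of u x 0] b_bound[of u] by simp

lemma velocity_absolutely_integrable:
  assumes u: "u \<in> controls U a s" and X: "continuous_on {a..s} X"
  shows "(\<lambda>t. b (X t) (u t)) absolutely_integrable_on {a..s}"
proof -
  obtain K where K: "\<And>t. t \<in> {a..s} \<Longrightarrow> \<bar>X t\<bar> \<le> K"
    using compact_imp_bounded[OF compact_continuous_image[OF X compact_Icc]]
    unfolding bounded_iff by (metis image_eqI real_norm_def)
  show ?thesis
  proof (rule bounded_measurable_absolutely_integrable[where C = "B + c * K"])
    fix t assume "t \<in> {a..s}"
    moreover from this have "u t \<in> U" using u by (auto simp: controls_def)
    ultimately show "\<bar>b (X t) (u t)\<bar> \<le> B + c * K"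
      using b_growth[of "u t" "X t"] K[of t] c_pos
      by (meson add_left_mono less_imp_le mult_left_mono order_trans)
  qed (rule measurable_running[OF b_cont u X])
qed

lemma velocity_integrable:
  assumes u: "u \<in> controls U a s" and X: "continuous_on {a..s} X" and r: "r \<le> s" "a \<le> q"
  shows "(\<lambda>t. b (X t) (u t)) integrable_on {q..r}"
  using integrable_on_subinterval[of "\<lambda>t. b (X t) (u t)" "{a..s}" q r] 
    velocity_absolutely_integrable[OF u X] r
  by (auto simp: set_lebesgue_integral_eq_integral(1))

text \<open>Replaces the Lebesgue integrals of \<open>is_state\<close> by Henstock-Kurzweil ones.
  Integrability is automatic, the velocity along a continuous \<open>X\<close> being bounded and
  measurable.\<close>

lemma is_state_iff:
  assumes u: "u \<in> controls U a s"
  shows "is_state b a s y u X \<longleftrightarrow> continuous_on {a..s} X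
    \<and> (\<forall>r\<in>{a..s}. X r = y + integral {a..r} (\<lambda>\<tau>. b (X \<tau>) (u \<tau>)))"
proof -
  have "integral\<^sup>L (lebesgue_on {a..r}) (\<lambda>\<tau>. b (X \<tau>) (u \<tau>)) = integral {a..r} (\<lambda>\<tau>. b (X \<tau>) (u \<tau>))"
    if "continuous_on {a..s} X" "r \<in> {a..s}" for r
  proof (rule lebesgue_integral_eq_integral)
    have "(\<lambda>\<tau>. b (X \<tau>) (u \<tau>)) absolutely_integrable_on {a..r}"
      by (rule absolutely_integrable_on_subinterval[OF velocity_absolutely_integrable[OF u that(1)]])
        (use that in auto)
    then show "integrable (lebesgue_on {a..r}) (\<lambda>\<tau>. b (X \<tau>) (u \<tau>))"
      by (rule absolutely_integrable_imp_integrable) auto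
  qed auto
  moreover have "integrable (lebesgue_on {a..s}) (\<lambda>\<tau>. b (X \<tau>) (u \<tau>))" if "continuous_on {a..s} X"
    by (rule absolutely_integrable_imp_integrable[OF velocity_absolutely_integrable[OF u that]]) auto
  ultimately show ?thesis by (auto simp: is_state_def)
qed

lemma state_exists:
  assumes u: "u \<in> controls U a s" and as: "a \<le> s"
  shows "\<exists>X. is_state b a s y u X"
proof -
  \<comment> \<open>The weight \<open>exp (- 2 * c * (t - a))\<close> makes the Picard operator a contraction on the whole interval.\<close>
  define K where "K = 2 * c"
  \<comment> \<open>The unknown is the rescaled \<open>Z t = exp (- K * (t - a)) * X t\<close>, so
    that the weighted norm of \<open>X\<close> is the plain sup norm of \<open>Z\<close>;
    \<open>h\<close> is the Picard operator in this variable.\<close>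
  define G where "G Z = (\<lambda>\<tau>. b (exp (K * (\<tau> - a)) * apply_bcontfun Z \<tau>) (u \<tau>))" for Z
  define h where "h Z t = exp (- K * (t - a)) * (y + integral {a..t} (G Z))" for Z t
  have cZ: "continuous_on {a..s} (\<lambda>\<tau>. exp (K * (\<tau> - a)) * apply_bcontfun Z \<tau>)" for Z
    by (intro continuous_intros continuous_on_apply_bcontfun)
  have G_int: "G Z integrable_on {a..t}" if "t \<in> {a..s}" for Z t
    unfolding G_def using velocity_integrable[OF u cZ, of t a] that by auto
  \<comment> \<open>The complete space in use consists of bounded continuous functions on the whole
    line; \<open>clamp\<close> extends \<open>h Z\<close> from \<open>[a,s]\<close> by its end
    values.\<close>
  have "continuous_on {a..s} (h Z)" for Z
    unfolding h_def
    by (intro continuous_intros indefinite_integral_continuous_1 G_int) (use as in auto)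
  then have "\<exists>g::real \<Rightarrow>\<^sub>C real. \<forall>x. apply_bcontfun g x = h Z (clamp a s x)" for Z
    using continuous_on_cbox_bcontfunE[of a s "h Z"] by (metis box_real(2))
  then obtain F where F: "\<And>Z x. apply_bcontfun (F Z) x = h Z (clamp a s x)"
    by metis
  have clamp_in: "clamp a s x \<in> {a..s}" for x
    using clamp_in_interval[of a s x] as by auto
  have "dist (F Z) (F W) \<le> 1/2 * dist Z W" for Z W
  proof (rule dist_bound)
    fix x
    define t where "t = clamp a s x"
    have t: "t \<in> {a..s}" unfolding t_def by (rule clamp_in)
    \<comment> \<open>The contraction factor \<open>1/2\<close> arises here: integrating the weight
      divides by \<open>K = 2 * c\<close>, while the Lipschitz constant contributes only
      \<open>c\<close>.\<close>
    have e: "((\<lambda>\<tau>. c * exp (K * (\<tau> - a)) * dist Z W) has_integral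
       (exp (K * (t - a)) * dist Z W / 2 - exp (K * (a - a)) * dist Z W / 2)) {a..t}"
      by (rule fundamental_theorem_of_calculus)
        (use t in \<open>auto intro!: derivative_eq_intros simp: K_def simp flip: has_real_derivative_iff_has_vector_derivative\<close>)
    have "norm (integral {a..t} (\<lambda>\<tau>. G Z \<tau> - G W \<tau>)) \<le> integral {a..t} (\<lambda>\<tau>. c * exp (K * (\<tau> - a)) * dist Z W)"
    proof (rule integral_norm_bound_integral)
      show "norm (G Z \<tau> - G W \<tau>) \<le> c * exp (K * (\<tau> - a)) * dist Z W" if "\<tau> \<in> {a..t}" for \<tau>
      proof -
        have "u \<tau> \<in> U" using u that t by (auto simp: controls_def)
        then have "\<bar>G Z \<tau> - G W \<tau>\<bar> \<le> c * \<bar>exp (K * (\<tau> - a)) * Z \<tau> - exp (K * (\<tau> - a)) * W \<tau>\<bar>"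
          unfolding G_def by (rule b_lipschitz)
        also have "\<dots> = c * exp (K * (\<tau> - a)) * \<bar>Z \<tau> - W \<tau>\<bar>"
          by (simp add: abs_mult flip: right_diff_distrib)
        also have "\<dots> \<le> c * exp (K * (\<tau> - a)) * dist Z W"
          using dist_bounded[of Z \<tau> W] c_pos by (intro mult_left_mono) (auto simp: dist_real_def)
        finally show ?thesis by simp
      qed
    qed (use t e in \<open>auto intro!: integrable_diff G_int\<close>)
    also have "\<dots> \<le> exp (K * (t - a)) * dist Z W / 2"
      using integral_unique[OF e] by simp
    finally have *: "\<bar>integral {a..t} (G Z) - integral {a..t} (G W)\<bar> \<le> exp (K * (t - a)) * dist Z W / 2"
      using t by (simp add: integral_diff G_int)
    have "dist (F Z x) (F W x) = exp (- K * (t - a)) * \<bar>integral {a..t} (G Z) - integral {a..t} (G W)\<bar>"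
      by (simp add: F h_def dist_real_def abs_mult flip: right_diff_distrib t_def)
    also have "\<dots> \<le> exp (- K * (t - a)) * (exp (K * (t - a)) * dist Z W / 2)"
      using * by (rule mult_left_mono) simp
    also have "\<dots> = 1/2 * dist Z W"
      by (simp flip: exp_add mult.assoc)
    finally show "dist (F Z x) (F W x) \<le> 1/2 * dist Z W" .
  qed
  then obtain Z where Z: "F Z = Z"
    using banach_fix_type[of "1/2" F] by auto
  define X where "X t = exp (K * (t - a)) * Z t" for t
  have "X t = y + integral {a..t} (\<lambda>\<tau>. b (X \<tau>) (u \<tau>))" if t: "t \<in> {a..s}" for t
  proof -
    have "Z t = h Z t" using F[of Z t] Z t by (simp add: clamp_cancel_cbox)
    then show ?thesis
      by (simp add: X_def h_def G_def flip: exp_add mult.assoc)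
  qed
  then have "is_state b a s y u X"
    unfolding is_state_iff[OF u] using cZ[of Z] by (auto simp: X_def)
  then show ?thesis by (rule exI[of _ X])
qed

section \<open>Comparison, uniqueness and a priori bounds for trajectories\<close>

lemma B_nonneg: "u \<in> controls U a s \<Longrightarrow> a \<le> s \<Longrightarrow> 0 \<le> B"
  using order_trans[OF abs_ge_zero b_bound[of "u a"]] by (simp add: controls_def)

lemma stateD:
  assumes "u \<in> controls U a s" "is_state b a s y u X"
  shows "continuous_on {a..s} X"
    and "\<And>r. r \<in> {a..s} \<Longrightarrow> X r = y + integral {a..r} (\<lambda>\<tau>. b (X \<tau>) (u \<tau>))"
  using assms(2) by (simp_all add: is_state_iff[OF assms(1)])

lemma state_increment:
  assumes u: "u \<in> controls U a s" and X: "is_state b a s y u X" and qr: "a \<le> q" "q \<le> r" "r \<le> s"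
  shows "X r = X q + integral {q..r} (\<lambda>\<tau>. b (X \<tau>) (u \<tau>))"
proof -
  have "integral {a..q} (\<lambda>\<tau>. b (X \<tau>) (u \<tau>)) + integral {q..r} (\<lambda>\<tau>. b (X \<tau>) (u \<tau>))
      = integral {a..r} (\<lambda>\<tau>. b (X \<tau>) (u \<tau>))"
    by (rule Henstock_Kurzweil_Integration.integral_combine)
      (use qr velocity_integrable[OF u stateD(1)[OF u X]] in auto)
  then show ?thesis using stateD(2)[OF u X, of q] stateD(2)[OF u X, of r] qr by auto
qed

lemma state_diff_increment:
  assumes u: "u \<in> controls U a s" and X: "is_state b a s y u X"
    and v: "v \<in> controls U a s" and Y: "is_state b a s z v Y"
    and qr: "a \<le> q" "q \<le> r" "r \<le> s"
  shows "Y r - X r = Y q - X q + integral {q..r} (\<lambda>\<tau>. b (Y \<tau>) (v \<tau>) - b (X \<tau>) (u \<tau>))"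
proof -
  have "integral {q..r} (\<lambda>\<tau>. b (Y \<tau>) (v \<tau>) - b (X \<tau>) (u \<tau>))
      = integral {q..r} (\<lambda>\<tau>. b (Y \<tau>) (v \<tau>)) - integral {q..r} (\<lambda>\<tau>. b (X \<tau>) (u \<tau>))"
    by (rule integral_diff)
      (use qr velocity_integrable[OF u stateD(1)[OF u X]] velocity_integrable[OF v stateD(1)[OF v Y]] in auto)
  then show ?thesis
    using state_increment[OF u X qr] state_increment[OF v Y qr] by simp
qed

text \<open>Adding and subtracting \<open>b (X r) (v r)\<close> bounds the derivative of
  \<open>Y - X\<close> below by \<open>- c * \<bar>Y - X\<bar>\<close>. With equal controls and
  equal initial values, both directions together give uniqueness.\<close>

lemma state_mono:
  assumes u: "u \<in> controls U a s" and X: "is_state b a s y u X"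
    and v: "v \<in> controls U a s" and Y: "is_state b a s z v Y"
    and yz: "y \<le> z" and le: "\<And>x \<tau>. \<tau> \<in> {a..s} \<Longrightarrow> b x (u \<tau>) \<le> b x (v \<tau>)"
    and t: "t \<in> {a..s}"
  shows "X t \<le> Y t"
proof -
  have "0 \<le> Y t - X t"
  proof (rule nonneg_if_derivative_ge[where D="\<lambda>t. Y t - X t" and a=a and b=s])
    show "(\<lambda>\<tau>. b (Y \<tau>) (v \<tau>) - b (X \<tau>) (u \<tau>)) integrable_on {a..s}"
      by (intro integrable_diff velocity_integrable[OF u stateD(1)[OF u X]]
        velocity_integrable[OF v stateD(1)[OF v Y]]) auto
    show "Y r - X r = Y a - X a + integral {a..r} (\<lambda>\<tau>. b (Y \<tau>) (v \<tau>) - b (X \<tau>) (u \<tau>))"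
      if "r \<in> {a..s}" for r
      using state_diff_increment[OF u X v Y, of a r] that by simp
    show "- c * \<bar>Y r - X r\<bar> \<le> b (Y r) (v r) - b (X r) (u r)" if "r \<in> {a..s}" for r
    proof -
      have "v r \<in> U" using v that by (auto simp: controls_def)
      from b_lipschitz[OF this, of "Y r" "X r"] le[OF that, of "X r"] show ?thesis by linarith
    qed
    show "0 \<le> Y a - X a"
      using stateD(2)[OF u X, of a] stateD(2)[OF v Y, of a] yz t by simp
  qed (use c_pos t in auto)
  then show ?thesis by simp
qed

lemma state_unique:
  assumes u: "u \<in> controls U a s" and X: "is_state b a s y u X" and Y: "is_state b a s y u Y"
    and t: "t \<in> {a..s}"
  shows "X t = Y t"
  using state_mono[OF u X u Y _ _ t] state_mono[OF u Y u X _ _ t] by simp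

text \<open>Linear growth and Gronwall for \<open>\<bar>X\<bar>\<close>. The bound does not involve
  the control, so one radius serves all trajectories starting at \<open>y\<close>.\<close>

lemma state_bound:
  assumes u: "u \<in> controls U a s" and X: "is_state b a s y u X" and t: "t \<in> {a..s}"
  shows "\<bar>X t\<bar> \<le> (\<bar>y\<bar> + B * (s - a)) * exp (c * (s - a))"
proof -
  have B0: "0 \<le> B" using B_nonneg[OF u] t by auto
  have cont: "continuous_on {a..s} (\<lambda>t. \<bar>X t\<bar>)"
    by (intro continuous_intros stateD[OF u X])
  have "\<bar>X t\<bar> \<le> (\<bar>y\<bar> + B * (s - a)) + c * integral {a..t} (\<lambda>t. \<bar>X t\<bar>)" if t: "t \<in> {a..s}" for t
  proof -
    have Xint: "(\<lambda>t. \<bar>X t\<bar>) integrable_on {a..t}"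
      by (rule integrable_continuous_interval[OF continuous_on_subset[OF cont]]) (use t in auto)
    have "norm (integral {a..t} (\<lambda>\<tau>. b (X \<tau>) (u \<tau>))) \<le> integral {a..t} (\<lambda>\<tau>. B + c * \<bar>X \<tau>\<bar>)"
    proof (rule integral_norm_bound_integral)
      show "(\<lambda>\<tau>. b (X \<tau>) (u \<tau>)) integrable_on {a..t}"
        by (rule velocity_integrable[OF u stateD(1)[OF u X]]) (use t in auto)
      show "(\<lambda>\<tau>. B + c * \<bar>X \<tau>\<bar>) integrable_on {a..t}"
        using integrable_add[OF integrable_const_ivl integrable_on_cmult_left[OF Xint]] by simp
      show "norm (b (X \<tau>) (u \<tau>)) \<le> B + c * \<bar>X \<tau>\<bar>" if "\<tau> \<in> {a..t}" for \<tau>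
        using b_growth[of "u \<tau>" "X \<tau>"] u that t by (auto simp: controls_def)
    qed
    also have "\<dots> = B * (t - a) + c * integral {a..t} (\<lambda>t. \<bar>X t\<bar>)"
      using t by (subst integral_add) (auto intro!: integrable_on_cmult_left[OF Xint, simplified] simp: Xint)
    also have "\<dots> \<le> B * (s - a) + c * integral {a..t} (\<lambda>t. \<bar>X t\<bar>)"
      using t B0 by (auto intro: mult_left_mono)
    finally show ?thesis
      using stateD(2)[OF u X t] by simp
  qed
  from integral_gronwall[OF cont less_imp_le[OF c_pos] this t]
  have "\<bar>X t\<bar> \<le> (\<bar>y\<bar> + B * (s - a)) * exp (c * (t - a))" .
  also have "\<dots> \<le> (\<bar>y\<bar> + B * (s - a)) * exp (c * (s - a))"
    using t B0 c_pos by (intro mult_left_mono) auto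
  finally show ?thesis .
qed

text \<open>The speed is at most \<open>B + c * R\<close>. This limits how far a trajectory can fall
  below 0 after a partition point.\<close>

lemma state_decrease:
  assumes u: "u \<in> controls U a s" and X: "is_state b a s y u X"
    and R: "\<And>t. t \<in> {a..s} \<Longrightarrow> \<bar>X t\<bar> \<le> R" and qr: "a \<le> q" "q \<le> r" "r \<le> s"
  shows "X q - (B + c * R) * (r - q) \<le> X r"
proof -
  have "norm (integral {q..r} (\<lambda>\<tau>. b (X \<tau>) (u \<tau>))) \<le> integral {q..r} (\<lambda>\<tau>. B + c * R)"
  proof (rule integral_norm_bound_integral)
    show "(\<lambda>\<tau>. b (X \<tau>) (u \<tau>)) integrable_on {q..r}"
      by (rule velocity_integrable[OF u stateD(1)[OF u X]]) (use qr in auto)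
    show "norm (b (X \<tau>) (u \<tau>)) \<le> B + c * R" if "\<tau> \<in> {q..r}" for \<tau>
    proof -
      have "u \<tau> \<in> U" "\<bar>X \<tau>\<bar> \<le> R" using u R[of \<tau>] that qr by (auto simp: controls_def)
      then show ?thesis
        using b_growth[of "u \<tau>" "X \<tau>"] c_pos real_norm_def
        by (metis add_left_mono less_imp_le mult_left_mono order_trans)
    qed
  qed auto
  then show ?thesis using state_increment[OF u X qr] qr by (simp add: algebra_simps abs_le_iff)
qed

text \<open>If no control pushes upwards at 0, then
  \<open>b (X r) (u r) \<le> c * \<bar>X r\<bar>\<close>. Hence a negative value decays at most
  exponentially in size and is still negative at \<open>s\<close>.\<close>

lemma state_nonneg_if_terminal_nonneg:
  assumes b0: "\<And>u. u \<in> U \<Longrightarrow> b 0 u \<le> 0"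
    and u: "u \<in> controls U a s" and X: "is_state b a s y u X" and Xs: "0 \<le> X s" and t: "t \<in> {a..s}"
  shows "0 \<le> X t"
proof (rule ccontr)
  assume neg: "\<not> 0 \<le> X t"
  have "- X t * exp (- c * (s - t)) \<le> - X s"
  proof (rule exp_lower_bound_if_derivative_ge[where D="\<lambda>t. - X t" and a=t and b=s])
    have int: "(\<lambda>\<tau>. b (X \<tau>) (u \<tau>)) integrable_on {t..s}"
      by (rule velocity_integrable[OF u stateD(1)[OF u X]]) (use t in auto)
    then show "(\<lambda>\<tau>. - b (X \<tau>) (u \<tau>)) integrable_on {t..s}" by (simp add: integrable_neg)
    show "- X r = - X t + integral {t..r} (\<lambda>\<tau>. - b (X \<tau>) (u \<tau>))" if "r \<in> {t..s}" for r
      using state_increment[OF u X, of t r] t that by simp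
    show "- c * \<bar>- X r\<bar> \<le> - b (X r) (u r)" if "r \<in> {t..s}" for r
    proof -
      have "u r \<in> U" using u t that by (auto simp: controls_def)
      from b_lipschitz[OF this, of "X r" 0] b0[OF this] show ?thesis by auto
    qed
  qed (use c_pos neg t in auto)
  moreover have "0 < - X t * exp (- c * (s - t))" using neg by (simp add: mult_neg_pos)
  ultimately show False using Xs by linarith
qed

text \<open>By the Lipschitz condition \<open>b (X r) (u r) \<ge> - c * \<bar>X r\<bar>\<close>
  wherever the drift at 0 is nonnegative. The drift is constrained only up to \<open>t\<close>, as
  the repaired control has this property only on an initial interval.\<close>

lemma state_nonneg_if_drift_nonneg:
  assumes u: "u \<in> controls U a s" and X: "is_state b a s y u X" and y: "0 \<le> y"
    and b0: "\<And>r. r \<in> {a..t} \<Longrightarrow> 0 \<le> b 0 (u r)" and t: "t \<in> {a..s}"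
  shows "0 \<le> X t"
proof (rule nonneg_if_derivative_ge[where D=X and a=a and b=t])
  show "(\<lambda>\<tau>. b (X \<tau>) (u \<tau>)) integrable_on {a..t}"
    by (rule velocity_integrable[OF u stateD(1)[OF u X]]) (use t in auto)
  show "X r = X a + integral {a..r} (\<lambda>\<tau>. b (X \<tau>) (u \<tau>))" if "r \<in> {a..t}" for r
    using state_increment[OF u X, of a r] t that by simp
  show "- c * \<bar>X r\<bar> \<le> b (X r) (u r)" if "r \<in> {a..t}" for r
  proof -
    have "u r \<in> U" using u t that by (auto simp: controls_def)
    from b_lipschitz[OF this, of "X r" 0] b0[OF that] show ?thesis by auto
  qed
  show "0 \<le> X a" using stateD(2)[OF u X, of a] t y by auto
qed (use c_pos t in auto)

section \<open>Evaluating the cost along a trajectory\<close>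

lemma running_cost_absolutely_integrable:
  fixes f :: "real \<Rightarrow> real \<Rightarrow> real"
  assumes f: "continuous_on (UNIV \<times> U) (\<lambda>(x, u). f x u)"
    and u: "u \<in> controls U a s" and X: "is_state b a s y u X"
    and F: "\<And>t. t \<in> {a..s} \<Longrightarrow> \<bar>f (X t) (u t)\<bar> \<le> F"
  shows "(\<lambda>t. f (X t) (u t)) absolutely_integrable_on {a..s}"
  by (intro bounded_measurable_absolutely_integrable measurable_running[OF f u stateD(1)[OF u X]])
    (rule F)

text \<open>\<open>X\<close> witnesses that the choice in \<open>state\<close> yields a solution,
  and uniqueness identifies that solution with \<open>X\<close> on \<open>[0,T]\<close>.\<close>

lemma cost_eq:
  fixes f :: "real \<Rightarrow> real \<Rightarrow> real"
  assumes f: "continuous_on (UNIV \<times> U) (\<lambda>(x, u). f x u)"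
    and u: "u \<in> controls U 0 T" and X: "is_state b 0 T y u X" and T: "0 \<le> T"
    and F: "\<And>t. t \<in> {0..T} \<Longrightarrow> \<bar>f (X t) (u t)\<bar> \<le> F"
  shows "cost b f \<Psi> T y u = integral {0..T} (\<lambda>t. f (X t) (u t)) + \<Psi> (X T)"
proof -
  have "is_state b 0 T y u (state b T y u)"
    unfolding state_def by (rule someI[of "is_state b 0 T y u", OF X])
  then have eq: "state b T y u t = X t" if "t \<in> {0..T}" for t
    using state_unique[OF u _ X that] by blast
  have "(\<integral>t. f (state b T y u t) (u t) \<partial>lebesgue_on {0..T}) = (\<integral>t. f (X t) (u t) \<partial>lebesgue_on {0..T})"
    by (rule Bochner_Integration.integral_cong) (auto simp: eq)
  also have "\<dots> = integral {0..T} (\<lambda>t. f (X t) (u t))"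
    by (intro lebesgue_integral_eq_integral absolutely_integrable_imp_integrable
      running_cost_absolutely_integrable[OF f u X F]) auto
  finally show ?thesis using T by (simp add: cost_def eq)
qed

end

section \<open>Repairing constraint violations between partition points\<close>

text \<open>The measure of \<open>E \<inter> {0..r}\<close> is continuous in \<open>r\<close>, as an
  indefinite integral of the indicator, and vanishes at 0. Either it attains
  \<open>\<epsilon>\<close> or \<open>\<sigma> = T\<close> keeps it below.\<close>

lemma exists_initial_part_of_measure:
  fixes E :: "real set"
  assumes E: "E \<in> sets lebesgue" and T: "0 \<le> T" and \<epsilon>: "0 \<le> \<epsilon>"
  obtains \<sigma> where "\<sigma> \<in> {0..T}" "measure lebesgue (E \<inter> {0..\<sigma>}) \<le> \<epsilon>"
    "\<sigma> = T \<or> measure lebesgue (E \<inter> {0..\<sigma>}) = \<epsilon>"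
proof -
  have lm: "E \<inter> {0..r} \<in> lmeasurable" for r :: real
    using fmeasurable_Int_fmeasurable[of "{0..r}" lebesgue E] E by (simp add: Int_commute)
  have "continuous_on {0..T} (\<lambda>r. measure lebesgue (E \<inter> {0..r}))"
    using indefinite_integral_continuous_1[of "indicat_real E" 0 T] lm
    by (simp add: integrable_on_indicator Equivalence_Lebesgue_Henstock_Integration.integral_indicator)
  then have "\<exists>\<sigma>\<ge>0. \<sigma> \<le> T \<and> measure lebesgue (E \<inter> {0..\<sigma>}) = \<epsilon>"
    if "\<epsilon> \<le> measure lebesgue (E \<inter> {0..T})"
    using IVT'[of "\<lambda>r. measure lebesgue (E \<inter> {0..r})" 0 \<epsilon> T] that T \<epsilon>
    by (cases "0 \<in> E") auto
  then show thesis using that T by (cases "\<epsilon> \<le> measure lebesgue (E \<inter> {0..T})") force+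
qed

lemma controls_const: "w \<in> U \<Longrightarrow> (\<lambda>_. w) \<in> controls U a s"
  by (auto simp: controls_def finite_measure.integrable_const finite_measure_lebesgue_on)

lemma controls_If:
  assumes u: "u \<in> controls U a s" and v: "v \<in> controls U a s" and A: "A \<in> sets lebesgue"
  shows "(\<lambda>t. if t \<in> A then v t else u t) \<in> controls U a s"
proof -
  have [measurable]: "u \<in> borel_measurable (lebesgue_on {a..s})" "v \<in> borel_measurable (lebesgue_on {a..s})"
    using u v by (auto simp: controls_def)
  have m: "(\<lambda>t. if t \<in> A then v t else u t) \<in> borel_measurable (lebesgue_on {a..s})"
    by (rule measurable_If_set) (use A in \<open>auto simp: sets_restrict_space_iff\<close>)
  moreover have "integrable (lebesgue_on {a..s}) (\<lambda>r. (if r \<in> A then v r else u r)\<^sup>2)"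
  proof (rule Bochner_Integration.integrable_bound)
    show "integrable (lebesgue_on {a..s}) (\<lambda>r. (v r)\<^sup>2 + (u r)\<^sup>2)"
      using u v by (auto simp: controls_def)
    show "(\<lambda>r. (if r \<in> A then v r else u r)\<^sup>2) \<in> borel_measurable (lebesgue_on {a..s})"
      using m by measurable
  qed auto
  ultimately show ?thesis using u v by (auto simp: controls_def)
qed

context control_system
begin

text \<open>Switching to \<open>w\<close> raises the velocity at a fixed state by at least
  \<open>\<rho>\<close> and at most \<open>M\<close>. The factor \<open>exp (c * T)\<close> is the
  Gronwall growth of the gap, \<open>\<rho> * \<epsilon> / (1 + c * T)\<close> a gap certainly
  reached by time \<open>\<sigma>\<close>, and \<open>exp (- c * T)\<close> its worst later
  decay.\<close>

lemma perturbed_state: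
  assumes T: "0 < T" and u: "u \<in> controls U 0 T" and X: "is_state b 0 T y u X" and y: "0 \<le> y"
    and w: "w \<in> U" "0 < b 0 w"
    and \<rho>: "0 < \<rho>" "\<And>x u. u \<in> U \<Longrightarrow> b 0 u \<le> b 0 w / 2 \<Longrightarrow> \<rho> \<le> b x w - b x u"
    and M: "\<And>x u. u \<in> U \<Longrightarrow> b x w - b x u \<le> M" and \<epsilon>: "0 < \<epsilon>"
  obtains v Y A where "v \<in> controls U 0 T" "is_state b 0 T y v Y"
    and "A \<in> sets lebesgue" "A \<subseteq> {0..T}" "measure lebesgue A \<le> \<epsilon>" "\<And>t. t \<notin> A \<Longrightarrow> v t = u t"
    and "\<And>t. t \<in> {0..T} \<Longrightarrow> \<bar>Y t - X t\<bar> \<le> M * \<epsilon> * exp (c * T)"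
    and "\<And>t. t \<in> {0..T} \<Longrightarrow> X t + \<rho> * \<epsilon> / (1 + c * T) * exp (- c * T) \<le> Y t \<or> 0 \<le> Y t"
proof -
  have M0: "0 \<le> M" using M[OF w(1), of 0] by simp
  define E where "E = {t \<in> {0..T}. b 0 (u t) \<le> b 0 w / 2}"
  have "E \<in> sets (lebesgue_on {0..T})"
  proof -
    have [measurable]: "(\<lambda>t. b 0 (u t)) \<in> borel_measurable (lebesgue_on {0..T})"
      by (rule measurable_running[OF b_cont u]) auto
    have "{t \<in> space (lebesgue_on {0..T}). b 0 (u t) \<le> b 0 w / 2} \<in> sets (lebesgue_on {0..T})"
      by measurable
    then show ?thesis by (simp add: E_def)
  qed
  then have E: "E \<in> sets lebesgue" by (simp add: sets_restrict_space_iff)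
  obtain \<sigma> where \<sigma>: "\<sigma> \<in> {0..T}" "measure lebesgue (E \<inter> {0..\<sigma>}) \<le> \<epsilon>"
    "\<sigma> = T \<or> measure lebesgue (E \<inter> {0..\<sigma>}) = \<epsilon>"
    using exists_initial_part_of_measure[OF E less_imp_le[OF T] less_imp_le[OF \<epsilon>]] by blast
  define A where "A = E \<inter> {0..\<sigma>}"
  have A: "A \<in> sets lebesgue" "A \<subseteq> {0..T}" "measure lebesgue A \<le> \<epsilon>"
    using E \<sigma> by (auto simp: A_def)
  have A_lm: "A \<inter> {0..r} \<in> lmeasurable" for r :: real
    using fmeasurable_Int_fmeasurable[of "{0..r}" lebesgue A] A by (simp add: Int_commute)
  have A_int: "indicat_real A integrable_on {0..r}" for r
    using A_lm by (simp add: integrable_on_indicator)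
  have A_lm': "A \<in> lmeasurable" using A_lm[of T] A(2) by (simp add: Int_absorb2)
  have A_le: "integral {0..r} (indicat_real A) \<le> \<epsilon>" for r
    using A_lm[of r] A measure_mono_fmeasurable[of "A \<inter> {0..r}" A lebesgue] A_lm'
    by (auto simp: Equivalence_Lebesgue_Henstock_Integration.integral_indicator)
  define v where "v t = (if t \<in> A then w else u t)" for t
  have v: "v \<in> controls U 0 T"
    unfolding v_def by (rule controls_If[OF u controls_const[OF w(1)] A(1)])
  obtain Y where Y: "is_state b 0 T y v Y"
    using state_exists[OF v] T by auto
  define D where "D t = Y t - X t" for t
  define g where "g t = b (Y t) (v t) - b (X t) (u t)" for t
  have D_eq: "D r = D q + integral {q..r} g" if "0 \<le> q" "q \<le> r" "r \<le> T" for q r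
    unfolding D_def g_def by (rule state_diff_increment[OF u X v Y that])
  have D0: "D 0 = 0"
    using stateD(2)[OF u X, of 0] stateD(2)[OF v Y, of 0] T by (simp add: D_def)
  have g_int: "g integrable_on {q..r}" if "0 \<le> q" "r \<le> T" for q r
    unfolding g_def using that
    by (intro integrable_diff velocity_integrable[OF u stateD(1)[OF u X]]
      velocity_integrable[OF v stateD(1)[OF v Y]]) auto
  have uU: "u t \<in> U" and vU: "v t \<in> U" if "t \<in> {0..T}" for t
    using u v that by (auto simp: controls_def)
  \<comment> \<open>Split \<open>g\<close> at \<open>b (X t) (v t)\<close>: the change of control
    contributes only on \<open>A\<close>, the change of state at most
    \<open>c * \<bar>D t\<bar>\<close>.\<close>
  have g_lower: "\<rho> * indicat_real A t - c * \<bar>D t\<bar> \<le> g t"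
    and g_upper: "g t \<le> M * indicat_real A t + c * \<bar>D t\<bar>" if "t \<in> {0..T}" for t
  proof -
    have "\<rho> * indicat_real A t \<le> b (X t) (v t) - b (X t) (u t)"
      "b (X t) (v t) - b (X t) (u t) \<le> M * indicat_real A t"
      using \<rho>(2)[OF uU[OF that]] M[OF uU[OF that]] by (auto simp: v_def A_def E_def)
    with b_lipschitz[OF vU[OF that], of "Y t" "X t"]
    show "\<rho> * indicat_real A t - c * \<bar>D t\<bar> \<le> g t" "g t \<le> M * indicat_real A t + c * \<bar>D t\<bar>"
      unfolding D_def g_def by linarith+
  qed
  have g_lower': "- c * \<bar>D t\<bar> \<le> g t" if "t \<in> {0..T}" for t
    using g_lower[OF that] mult_nonneg_nonneg[OF less_imp_le[OF \<rho>(1)], of "indicat_real A t"] by simp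
  have D_nonneg: "0 \<le> D t" if "t \<in> {0..T}" for t
  proof (rule nonneg_if_derivative_ge[where D=D and g=g and c=c])
    show "D r = D 0 + integral {0..r} g" if "r \<in> {0..T}" for r
      using D_eq[of 0 r] that by auto
  qed (use that c_pos g_int g_lower' D0 in auto)
  have D_cont: "continuous_on {0..T} D"
    unfolding D_def by (intro continuous_intros stateD(1)[OF u X] stateD(1)[OF v Y])
  have D_int: "D integrable_on {0..r}" if "r \<le> T" for r
    by (rule integrable_continuous_interval[OF continuous_on_subset[OF D_cont]]) (use that in auto)
  have D_upper: "D t \<le> M * \<epsilon> * exp (c * T)" if t: "t \<in> {0..T}" for t
  proof -
    have "D r \<le> M * \<epsilon> + c * integral {0..r} D" if r: "r \<in> {0..T}" for r
    proof -
      have "integral {0..r} g \<le> integral {0..r} (\<lambda>t. M * indicat_real A t + c * D t)"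
      proof (rule integral_le)
        show "g t \<le> M * indicat_real A t + c * D t" if "t \<in> {0..r}" for t
          using g_upper[of t] D_nonneg[of t] that r by auto
      qed (use g_int D_int A_int r in \<open>auto intro!: integrable_add integrable_on_mult_right\<close>)
      also have "\<dots> = M * integral {0..r} (indicat_real A) + c * integral {0..r} D"
        using A_int D_int r
        by (subst integral_add) (auto intro!: integrable_on_mult_right)
      also have "\<dots> \<le> M * \<epsilon> + c * integral {0..r} D"
        using A_le[of r] M0 by (simp add: mult_left_mono)
      finally show ?thesis using D_eq[of 0 r] D0 r by auto
    qed
    from integral_gronwall[OF D_cont less_imp_le[OF c_pos] this t]
    have "D t \<le> M * \<epsilon> * exp (c * t)" by simp
    also have "\<dots> \<le> M * \<epsilon> * exp (c * T)"
      using t M0 \<epsilon> c_pos by (intro mult_left_mono) auto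
    finally show ?thesis .
  qed
  have pos: "X t + \<rho> * \<epsilon> / (1 + c * T) * exp (- c * T) \<le> Y t \<or> 0 \<le> Y t" if t: "t \<in> {0..T}" for t
  proof (cases "t \<le> \<sigma>")
    case True
    \<comment> \<open>Up to \<open>\<sigma>\<close> a time lies in \<open>A\<close>, where
      \<open>w\<close> acts, or outside \<open>E\<close>, where the drift of \<open>u\<close> at 0
      exceeds \<open>b 0 w / 2\<close>.\<close>
    have "0 \<le> Y t"
    proof (rule state_nonneg_if_drift_nonneg[OF v Y y])
      show "0 \<le> b 0 (v r)" if "r \<in> {0..t}" for r
      proof (cases "r \<in> A")
        case True
        then show ?thesis using w(2) by (simp add: v_def)
      next
        case False
        then have "b 0 w / 2 < b 0 (u r)"
          using that t \<open>t \<le> \<sigma>\<close> by (simp add: A_def E_def)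
        then show ?thesis using False w(2) by (simp add: v_def)
      qed
    qed (rule t)
    then show ?thesis ..
  next
    case False
    define m where "m = \<rho> * \<epsilon> / (1 + c * T)"
    have cT: "0 < 1 + c * T" using c_pos T by (simp add: add_pos_pos)
    have m0: "0 < m" using \<rho> \<epsilon> cT by (simp add: m_def)
    have meas: "measure lebesgue A = \<epsilon>" using \<sigma> False t by (auto simp: A_def)
    \<comment> \<open>Since \<open>t > \<sigma>\<close>, the full measure \<open>\<epsilon>\<close>
      has been used. If \<open>D\<close> stayed below \<open>m\<close>, integrating the lower bound
      of \<open>g\<close> would give \<open>\<rho> * \<epsilon> < m * (1 + c * T)\<close>, contrary
      to the choice of \<open>m\<close>.\<close>
    have "\<exists>q\<in>{0..\<sigma>}. m \<le> D q"
    proof (rule ccontr)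
      assume "\<not> (\<exists>q\<in>{0..\<sigma>}. m \<le> D q)"
      then have less: "D q < m" if "q \<in> {0..\<sigma>}" for q using that by force
      have "A \<inter> {0..\<sigma>} = A" by (auto simp: A_def)
      then have "\<rho> * \<epsilon> - c * m * \<sigma> = integral {0..\<sigma>} (\<lambda>t. \<rho> * indicat_real A t - c * m)"
        using A_int[of \<sigma>] A_lm[of \<sigma>] \<sigma>(1) meas
        by (subst integral_diff)
          (auto simp: Equivalence_Lebesgue_Henstock_Integration.integral_indicator
            intro!: integrable_on_mult_right)
      also have "\<dots> \<le> integral {0..\<sigma>} g"
      proof (rule integral_le)
        show "\<rho> * indicat_real A t - c * m \<le> g t" if "t \<in> {0..\<sigma>}" for t
        proof -
          have "t \<in> {0..T}" using that \<sigma> by auto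
          moreover have "c * D t \<le> c * m" using less[OF that] c_pos by simp
          ultimately show ?thesis
            using g_lower[of t] D_nonneg[of t] by simp
        qed
      qed (use A_int g_int \<sigma> in \<open>auto intro!: integrable_diff integrable_on_mult_right\<close>)
      also have "\<dots> = D \<sigma>" using D_eq[of 0 \<sigma>] D0 \<sigma> by auto
      also have "\<dots> < m" using less \<sigma> by auto
      finally have "\<rho> * \<epsilon> < m + c * m * \<sigma>" by simp
      also have "\<dots> \<le> m + c * m * T"
        using \<sigma> c_pos m0 by (auto intro!: mult_left_mono)
      also have "\<dots> = m * (1 + c * T)" by (simp add: algebra_simps)
      also have "\<dots> = \<rho> * \<epsilon>" using cT by (simp add: m_def)
      finally show False by simp
    qed
    then obtain q where q: "q \<in> {0..\<sigma>}" "m \<le> D q" by blast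
    have "m * exp (- c * T) \<le> m * exp (- c * (t - q))"
      using t q m0 c_pos by (intro mult_left_mono) auto
    also have "\<dots> \<le> D t"
    proof (rule exp_lower_bound_if_derivative_ge[where D=D and g=g and b=T])
      show "D r = D q + integral {q..r} g" if "r \<in> {q..T}" for r
        using D_eq[of q r] that q by auto
    qed (use t q \<sigma> False c_pos g_int g_lower' m0 in auto)
    finally show ?thesis by (simp add: D_def m_def)
  qed
  show thesis
  proof (rule that[OF v Y A])
    show "\<bar>Y t - X t\<bar> \<le> M * \<epsilon> * exp (c * T)" if "t \<in> {0..T}" for t
      using D_upper[OF that] D_nonneg[OF that] by (simp add: D_def)
  qed (use pos in \<open>auto simp: v_def\<close>)
qed

end

section \<open>Bounds, monotonicity and partitions obtained from the hypotheses\<close>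

lemma bounded_on_strip:
  fixes f :: "real \<Rightarrow> real \<Rightarrow> real"
  assumes f: "uniformly_continuous_on (UNIV \<times> U) (\<lambda>(x, u). f x u)" and U: "bounded U"
  obtains F where "0 < F" "\<And>x u. \<bar>x\<bar> \<le> R \<Longrightarrow> u \<in> U \<Longrightarrow> \<bar>f x u\<bar> \<le> F"
proof -
  have "uniformly_continuous_on ({-R..R} \<times> U) (\<lambda>(x, u). f x u)"
    using f unfolding uniformly_continuous_on_def by (meson Sigma_mono subsetD subset_UNIV order_refl)
  \<comment> \<open>\<open>U\<close> may fail to be closed, so uniform continuity on a bounded set
    replaces compactness.\<close>
  then have "bounded ((\<lambda>(x, u). f x u) ` ({-R..R} \<times> U))"
    by (rule bounded_uniformly_continuous_image) (auto intro: bounded_Times U)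
  then obtain F where "0 < F" "\<forall>y \<in> (\<lambda>(x, u). f x u) ` ({-R..R} \<times> U). norm y \<le> F"
    unfolding bounded_pos by blast
  then show thesis by (intro that[of F]) (force simp: abs_le_iff)+
qed

text \<open>For the constant control \<open>u\<close> the integral in (A2) is \<open>T\<close> times
  the square of \<open>\<bar>b 0 u\<bar>\<close>.\<close>

lemma abs_b0_bounded:
  assumes T: "0 < T"
    and A2: "\<exists>c>0. (SUP u\<in>controls U 0 T.
               (\<integral>\<^sup>+t. ennreal (\<bar>b 0 (u t)\<bar>\<^sup>2) \<partial>lebesgue_on {0..T})) \<le> ennreal c"
  obtains B :: real where "\<And>u. u \<in> U \<Longrightarrow> \<bar>b 0 u\<bar> \<le> B"
proof -
  obtain C where C: "0 < C" and sup: "(SUP u\<in>controls U 0 T.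
     (\<integral>\<^sup>+t. ennreal (\<bar>b 0 (u t)\<bar>\<^sup>2) \<partial>lebesgue_on {0..T})) \<le> ennreal C"
    using A2 by blast
  have "\<bar>b 0 u\<bar> \<le> sqrt (C / T)" if u: "u \<in> U" for u
  proof -
    have "(\<integral>\<^sup>+t. ennreal (\<bar>b 0 ((\<lambda>_. u) t)\<bar>\<^sup>2) \<partial>lebesgue_on {0..T}) \<le> ennreal C"
      by (rule order_trans[OF SUP_upper[OF controls_const[OF u]] sup])
    then have "ennreal (\<bar>b 0 u\<bar>\<^sup>2) * ennreal T \<le> ennreal C"
      using T by (simp add: emeasure_restrict_space)
    then have "\<bar>b 0 u\<bar>\<^sup>2 * T \<le> C"
      using C T by (simp add: ennreal_le_iff flip: ennreal_mult)
    then show ?thesis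
      using T by (intro real_le_rsqrt) (simp add: field_simps)
  qed
  then show thesis by (rule that)
qed

text \<open>A change of sign would force \<open>b z w = b z u\<close> at some \<open>z\<close> by
  the intermediate value theorem, and the lower bound in (A4) would give
  \<open>w = u\<close>.\<close>

lemma difference_sign_independent_of_state:
  fixes b :: "real \<Rightarrow> real \<Rightarrow> real"
  assumes c1: "0 < c1" and cont: "\<And>u. u \<in> U \<Longrightarrow> continuous_on UNIV (\<lambda>x. b x u)"
    and A4: "\<And>x u1 u2. u1 \<in> U \<Longrightarrow> u2 \<in> U \<Longrightarrow> c1 * \<bar>u1 - u2\<bar> \<le> \<bar>b x u1 - b x u2\<bar>"
    and u: "u \<in> U" "w \<in> U" "b x u < b x w"
  shows "b y u < b y w"
proof (rule ccontr)
  assume "\<not> b y u < b y w"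
  moreover have "connected (range (\<lambda>z. b z w - b z u))"
    by (intro connected_continuous_image continuous_intros cont u) auto
  ultimately have "0 \<in> range (\<lambda>z. b z w - b z u)"
    using connected_contains_Icc[of "range (\<lambda>z. b z w - b z u)" "b y w - b y u" "b x w - b x u"] u(3)
    by (auto simp: subset_iff)
  then obtain z where "b z w - b z u = 0" by auto
  with A4[OF u(2,1), of z] c1 have "w = u" by (simp add: mult_le_0_iff)
  with u(3) show False by simp
qed

lemma uniform_partition:
  assumes T: "0 < T" and h: "0 < h"
  obtains n p where "0 < n" "is_partition T n p"
    "\<And>t. t \<in> {0..T} \<Longrightarrow> \<exists>i\<le>n. p i \<le> t \<and> t - p i \<le> h"
proof -
  obtain n :: nat where n: "T / h < real n" using reals_Archimedean2 by blast
  have n0: "0 < n" using n T h by (metis divide_pos_pos less_trans of_nat_0_less_iff)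
  define p where "p i = T * real i / real n" for i
  have Tn: "T / real n \<le> h" using n n0 h by (simp add: field_simps)
  show thesis
  proof (rule that[OF n0])
    show "is_partition T n p"
      using T n0 by (auto simp: is_partition_def p_def divide_strict_right_mono)
    fix t assume t: "t \<in> {0..T}"
    \<comment> \<open>The index equals \<open>n\<close> at \<open>t = T\<close>, hence the bound
      \<open>i \<le> n\<close> instead of a strict one.\<close>
    define i where "i = nat \<lfloor>t * n / T\<rfloor>"
    have "0 \<le> t * n / T" using t T by simp
    then have i: "real i \<le> t * n / T" "t * n / T < real i + 1"
      by (auto simp: i_def)
    have "t * n / T \<le> n" using t T n0 by (simp add: field_simps)
    then have "i \<le> n" using i(1) by linarith
    moreover have "p i \<le> t" using i(1) n0 T by (simp add: p_def field_simps)
    moreover have "t \<le> T * (real i + 1) / real n"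
      using i(2) n0 T by (simp add: field_simps)
    then have "t - p i \<le> T / real n"
      by (simp add: p_def distrib_left add_divide_distrib)
    ultimately show "\<exists>i\<le>n. p i \<le> t \<and> t - p i \<le> h" using Tn by force
  qed
qed

text \<open>On \<open>A\<close> the running costs differ by at most \<open>2 * F\<close>; off
  \<open>A\<close> the controls agree and only the state changes, costing at most \<open>e\<close>.
  The last \<open>e\<close> pays for the terminal cost.\<close>

lemma (in control_system) cost_perturbation:
  fixes f :: "real \<Rightarrow> real \<Rightarrow> real"
  assumes f: "continuous_on (UNIV \<times> U) (\<lambda>(x, u). f x u)" and T: "0 < T"
    and u: "u \<in> controls U 0 T" and X: "is_state b 0 T y u X"
    and v: "v \<in> controls U 0 T" and Y: "is_state b 0 T y v Y"
    and A: "A \<in> sets lebesgue" "A \<subseteq> {0..T}" "measure lebesgue A \<le> \<epsilon>" "\<And>t. t \<notin> A \<Longrightarrow> v t = u t"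
    and FX: "\<And>t. t \<in> {0..T} \<Longrightarrow> \<bar>f (X t) (u t)\<bar> \<le> F"
    and FY: "\<And>t. t \<in> {0..T} \<Longrightarrow> \<bar>f (Y t) (v t)\<bar> \<le> F"
    and close: "\<And>t w. t \<in> {0..T} \<Longrightarrow> w \<in> U \<Longrightarrow> \<bar>f (Y t) w - f (X t) w\<bar> \<le> e"
    and Psi: "\<bar>\<Psi> (Y T) - \<Psi> (X T)\<bar> \<le> e"
  shows "\<bar>cost b f \<Psi> T y v - cost b f \<Psi> T y u\<bar> \<le> e * T + 2 * F * \<epsilon> + e"
proof -
  have F0: "0 \<le> F" using FX[of 0] T by auto
  have e0: "0 \<le> e" using Psi by simp
  have int: "(\<lambda>t. f (X t) (u t)) integrable_on {0..T}" "(\<lambda>t. f (Y t) (v t)) integrable_on {0..T}"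
    using running_cost_absolutely_integrable[OF f u X FX] running_cost_absolutely_integrable[OF f v Y FY]
    by (auto intro: set_lebesgue_integral_eq_integral(1))
  have A_lm: "A \<inter> {0..T} \<in> lmeasurable"
    using fmeasurable_Int_fmeasurable[of "{0..T}" lebesgue A] A by (simp add: Int_commute)
  have AT: "A \<inter> {0..T} = A" using A(2) by blast
  have A_int: "indicat_real A integrable_on {0..T}"
    using A_lm by (simp add: integrable_on_indicator)
  have "norm (integral {0..T} (\<lambda>t. f (Y t) (v t) - f (X t) (u t)))
      \<le> integral {0..T} (\<lambda>t. e + 2 * F * indicat_real A t)"
  proof (rule integral_norm_bound_integral)
    show "norm (f (Y t) (v t) - f (X t) (u t)) \<le> e + 2 * F * indicat_real A t" if t: "t \<in> {0..T}" for t
    proof (cases "t \<in> A")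
      case True
      then show ?thesis using FX[OF t] FY[OF t] e0 by simp
    next
      case False
      have "u t \<in> U" using u t by (auto simp: controls_def)
      with close[OF t this] A(4)[OF False] False show ?thesis by simp
    qed
  qed (use int A_int in \<open>auto intro!: integrable_diff integrable_add integrable_on_mult_right\<close>)
  also have "\<dots> = e * T + 2 * F * measure lebesgue A"
    using A_int A_lm AT T
    by (subst integral_add)
      (auto simp: Equivalence_Lebesgue_Henstock_Integration.integral_indicator intro!: integrable_on_mult_right)
  also have "\<dots> \<le> e * T + 2 * F * \<epsilon>"
    using A(3) F0 by (simp add: mult_left_mono)
  finally have "\<bar>integral {0..T} (\<lambda>t. f (Y t) (v t)) - integral {0..T} (\<lambda>t. f (X t) (u t))\<bar> \<le> e * T + 2 * F * \<epsilon>"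
    using int by (simp add: integral_diff)
  moreover have "cost b f \<Psi> T y u = integral {0..T} (\<lambda>t. f (X t) (u t)) + \<Psi> (X T)"
    by (rule cost_eq[OF f u X less_imp_le[OF T] FX])
  moreover have "cost b f \<Psi> T y v = integral {0..T} (\<lambda>t. f (Y t) (v t)) + \<Psi> (Y T)"
    by (rule cost_eq[OF f v Y less_imp_le[OF T] FY])
  ultimately show ?thesis using Psi by (simp add: abs_le_iff)
qed

text \<open>The partition is fixed before the control: the constants below do not depend on
  \<open>u\<close>, so one mesh serves every discretely feasible pair.\<close>

lemma (in control_system) cost_almost_attained_by_feasible:
  fixes f :: "real \<Rightarrow> real \<Rightarrow> real"
  assumes T: "0 < T" and U: "bounded U" and x0: "0 \<le> x0" and e: "0 < e"
    and f_uc: "uniformly_continuous_on (UNIV \<times> U) (\<lambda>(x, u). f x u)"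
    and Psi_uc: "uniformly_continuous_on UNIV \<Psi>"
    and c1: "0 < c1"
    and A4: "\<And>x u1 u2. u1 \<in> U \<Longrightarrow> u2 \<in> U \<Longrightarrow> c1 * \<bar>u1 - u2\<bar> \<le> \<bar>b x u1 - b x u2\<bar>"
      "\<And>x u1 u2. u1 \<in> U \<Longrightarrow> u2 \<in> U \<Longrightarrow> \<bar>b x u1 - b x u2\<bar> \<le> c2 * \<bar>u1 - u2\<bar>"
    and c2: "0 < c2"
  obtains n p where "0 < n" "is_partition T n p"
    "\<And>u X. admissible_pair b U T x0 (p ` {0..n}) u X
       \<Longrightarrow> \<exists>v Y. admissible_pair b U T x0 {0..T} v Y \<and> cost b f \<Psi> T x0 v \<le> cost b f \<Psi> T x0 u + e"
proof (cases "\<exists>w\<in>U. 0 < b 0 w")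
  case False
  \<comment> \<open>The trivial partition with points 0 and \<open>T\<close>.\<close>
  define p where "p i = T * real i" for i :: nat
  have part: "is_partition T 1 p" using T by (auto simp: is_partition_def p_def)
  show thesis
  proof (rule that[of 1 p])
    fix u X assume adm: "admissible_pair b U T x0 (p ` {0..1}) u X"
    then have u: "u \<in> controls U 0 T" and X: "is_state b 0 T x0 u X" and "0 \<le> X (p 1)"
      by (auto simp: admissible_pair_def state_set_def)
    then have "0 \<le> X T" by (simp add: p_def)
    then have "\<forall>t\<in>{0..T}. 0 \<le> X t"
      using state_nonneg_if_terminal_nonneg[OF _ u X] False by force
    with u X have "admissible_pair b U T x0 {0..T} u X"
      by (auto simp: admissible_pair_def state_set_def)
    then show "\<exists>v Y. admissible_pair b U T x0 {0..T} v Y \<and> cost b f \<Psi> T x0 v \<le> cost b f \<Psi> T x0 u + e"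
      using e by force
  qed (use part in auto)
next
  case True
  then obtain w where w: "w \<in> U" "0 < b 0 w" by blast
  have cont: "continuous_on UNIV (\<lambda>x. b x u)" if "u \<in> U" for u
    using continuous_on_compose2[OF b_cont continuous_on_Pair[OF continuous_on_id continuous_on_const]] that by force
  \<comment> \<open>If the drifts at 0 differ by \<open>b 0 w / 2\<close>, the upper bound in (A4)
    separates \<open>u\<close> from \<open>w\<close> by \<open>b 0 w / (2 * c2)\<close>; the lower
    bound turns this into a velocity gap \<open>\<rho>\<close> at every state.\<close>
  define \<rho> where "\<rho> = c1 * (b 0 w / (2 * c2))"
  have \<rho>: "0 < \<rho>" using c1 c2 w by (simp add: \<rho>_def)
  have \<rho>_le: "\<rho> \<le> b x w - b x u" if u: "u \<in> U" "b 0 u \<le> b 0 w / 2" for x u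
  proof -
    have "b 0 w / 2 \<le> c2 * \<bar>w - u\<bar>" using A4(2)[OF w(1) u(1), of 0] u(2) by linarith
    then have "b 0 w / (2 * c2) \<le> \<bar>w - u\<bar>" using c2 by (simp add: field_simps)
    then have "\<rho> \<le> c1 * \<bar>w - u\<bar>" unfolding \<rho>_def using c1 by (intro mult_left_mono) auto
    also have "\<dots> \<le> \<bar>b x w - b x u\<bar>" by (rule A4(1)[OF w(1) u(1)])
    also have "b x u < b x w"
      using difference_sign_independent_of_state[of c1 U b u w 0 x] c1 cont A4(1) u w by auto
    then have "\<bar>b x w - b x u\<bar> = b x w - b x u" by simp
    finally show ?thesis .
  qed
  obtain K where K: "0 < K" "\<And>u. u \<in> U \<Longrightarrow> \<bar>u\<bar> \<le> K" using U by (auto simp: bounded_pos)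
  define M where "M = c2 * (2 * K)"
  have M: "0 < M" using K c2 by (simp add: M_def)
  have M_ge: "b x w - b x u \<le> M" if u: "u \<in> U" for x u
  proof -
    have "b x w - b x u \<le> c2 * \<bar>w - u\<bar>" using A4(2)[OF w(1) u, of x] by linarith
    also have "\<dots> \<le> M" unfolding M_def
      using K(2)[OF u] K(2)[OF w(1)] c2 by (intro mult_left_mono) auto
    finally show ?thesis .
  qed
  define R where "R = (\<bar>x0\<bar> + B * (T - 0)) * exp (c * (T - 0))"
  have R: "\<bar>X t\<bar> \<le> R" if "u \<in> controls U 0 T" "is_state b 0 T x0 u X" "t \<in> {0..T}" for u X t
    unfolding R_def by (rule state_bound[OF that])
  obtain F where F: "0 < F" "\<And>x u. \<bar>x\<bar> \<le> R \<Longrightarrow> u \<in> U \<Longrightarrow> \<bar>f x u\<bar> \<le> F"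
    using bounded_on_strip[OF f_uc U] by blast
  \<comment> \<open>Half of \<open>e\<close> covers the changes of state and terminal cost; the
    other half is left for the change of control on \<open>A\<close>.\<close>
  define e' where "e' = e / 2 / (T + 1)"
  have e'_pos: "0 < e'" using e T by (simp add: e'_def)
  have e'_sum: "e' * T + e' = e / 2"
  proof -
    have "e' * T + e' = e' * (T + 1)" by (simp add: algebra_simps)
    also have "\<dots> = e / 2" unfolding e'_def using T nonzero_eq_divide_eq[of "T + 1" "e / 2 / (T + 1)" "e / 2"] by auto
    finally show ?thesis .
  qed
  obtain d1 where d1: "0 < d1" "\<And>x y u. u \<in> U \<Longrightarrow> \<bar>y - x\<bar> < d1 \<Longrightarrow> \<bar>f y u - f x u\<bar> < e'"
  proof -
    obtain d where "0 < d" and d: "\<And>z z'. z \<in> UNIV \<times> U \<Longrightarrow> z' \<in> UNIV \<times> U \<Longrightarrow> dist z' z < d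
        \<Longrightarrow> dist ((\<lambda>(x, u). f x u) z') ((\<lambda>(x, u). f x u) z) < e'"
      using f_uc e'_pos unfolding uniformly_continuous_on_def by blast
    show thesis
    proof (rule that[OF \<open>0 < d\<close>])
      show "\<bar>f y u - f x u\<bar> < e'" if "u \<in> U" "\<bar>y - x\<bar> < d" for x y u
        using d[of "(x, u)" "(y, u)"] that by (simp add: dist_Pair_Pair dist_real_def)
    qed
  qed
  obtain d2 where d2: "0 < d2" "\<And>x y. \<bar>y - x\<bar> < d2 \<Longrightarrow> \<bar>\<Psi> y - \<Psi> x\<bar> < e'"
    using Psi_uc e'_pos unfolding uniformly_continuous_on_def dist_real_def by blast
  \<comment> \<open>The first term yields \<open>2 * F * \<epsilon> \<le> e / 2\<close>; the second
    keeps the trajectories within half the moduli \<open>d1\<close> and \<open>d2\<close>.\<close>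
  define \<epsilon> where "\<epsilon> = min (e / (4 * F)) (min d1 d2 / (2 * M * exp (c * T)))"
  have \<epsilon>: "0 < \<epsilon>" using e F(1) d1(1) d2(1) M by (simp add: \<epsilon>_def)
  have \<epsilon>F: "2 * F * \<epsilon> \<le> e / 2"
  proof -
    have "\<epsilon> \<le> e / (4 * F)" by (simp add: \<epsilon>_def)
    then show ?thesis using F(1) by (simp add: field_simps)
  qed
  have \<epsilon>M: "M * \<epsilon> * exp (c * T) < min d1 d2"
  proof -
    have "\<epsilon> \<le> min d1 d2 / (2 * M * exp (c * T))" unfolding \<epsilon>_def by (rule min.cobounded2)
    then have "\<epsilon> * (2 * M * exp (c * T)) \<le> min d1 d2"
      using M by (subst (asm) pos_le_divide_eq) auto
    then have "2 * (M * \<epsilon> * exp (c * T)) \<le> min d1 d2" by (simp only: mult_ac)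
    moreover have "0 < M * \<epsilon> * exp (c * T)" using M \<epsilon> by simp
    ultimately show ?thesis by linarith
  qed
  define m where "m = \<rho> * \<epsilon> / (1 + c * T) * exp (- c * T)"
  have m: "0 < m" using \<rho> \<epsilon> c_pos T by (simp add: m_def add_pos_pos)
  \<comment> \<open>A positive speed bound, so that the mesh \<open>m / L\<close> is defined and
    limits the fall between partition points to \<open>m\<close>, the guaranteed gain of the
    repair.\<close>
  define L where "L = \<bar>B + c * R\<bar> + 1"
  have L: "0 < L" "B + c * R \<le> L" by (auto simp: L_def)
  obtain n p where n: "0 < n" and p: "is_partition T n p"
    and mesh: "\<And>t. t \<in> {0..T} \<Longrightarrow> \<exists>i\<le>n. p i \<le> t \<and> t - p i \<le> m / L"
    using uniform_partition[OF T, of "m / L"] m L(1) by auto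
  have p_nonneg: "0 \<le> p i" if "i \<le> n" for i
    using that
  proof (induction i)
    case (Suc i)
    then have "p i < p (Suc i)" using p by (auto simp: is_partition_def)
    with Suc show ?case by auto
  qed (use p in \<open>auto simp: is_partition_def\<close>)
  show thesis
  proof (rule that[OF n p])
    fix u X assume adm: "admissible_pair b U T x0 (p ` {0..n}) u X"
    then have u: "u \<in> controls U 0 T" and X: "is_state b 0 T x0 u X"
      and Xp: "\<And>i. i \<le> n \<Longrightarrow> 0 \<le> X (p i)"
      by (auto simp: admissible_pair_def state_set_def)
    have X_ge: "- m \<le> X t" if t: "t \<in> {0..T}" for t
    proof -
      obtain i where i: "i \<le> n" "p i \<le> t" "t - p i \<le> m / L" using mesh[OF t] by blast
      have "(B + c * R) * (t - p i) \<le> L * (m / L)"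
        using i L by (intro mult_mono) auto
      also have "\<dots> = m" using L(1) by simp
      finally show ?thesis
        using state_decrease[OF u X R[OF u X] p_nonneg[OF i(1)] i(2)] Xp[OF i(1)] t by simp
    qed
    obtain v Y A where v: "v \<in> controls U 0 T" and Y: "is_state b 0 T x0 v Y"
      and A: "A \<in> sets lebesgue" "A \<subseteq> {0..T}" "measure lebesgue A \<le> \<epsilon>" "\<And>t. t \<notin> A \<Longrightarrow> v t = u t"
      and XY: "\<And>t. t \<in> {0..T} \<Longrightarrow> \<bar>Y t - X t\<bar> \<le> M * \<epsilon> * exp (c * T)"
      and Y_ge: "\<And>t. t \<in> {0..T} \<Longrightarrow> X t + m \<le> Y t \<or> 0 \<le> Y t"
      using perturbed_state[OF T u X x0 w \<rho> \<rho>_le M_ge \<epsilon>] unfolding m_def by blast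
    have "0 \<le> Y t" if "t \<in> {0..T}" for t
      using Y_ge[OF that] X_ge[OF that] by linarith
    with v Y have adm': "admissible_pair b U T x0 {0..T} v Y"
      by (auto simp: admissible_pair_def state_set_def)
    have "\<bar>cost b f \<Psi> T x0 v - cost b f \<Psi> T x0 u\<bar> \<le> e' * T + 2 * F * \<epsilon> + e'"
    proof (rule cost_perturbation[OF uniformly_continuous_imp_continuous[OF f_uc] T u X v Y A])
      fix t assume t: "t \<in> {0..T}"
      have "u t \<in> U" "v t \<in> U" using u v t by (auto simp: controls_def)
      then show "\<bar>f (X t) (u t)\<bar> \<le> F" "\<bar>f (Y t) (v t)\<bar> \<le> F"
        using F(2) R[OF u X t] R[OF v Y t] by blast+
      show "\<bar>f (Y t) q - f (X t) q\<bar> \<le> e'" if "q \<in> U" for q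
        using d1(2)[OF that, of "Y t" "X t"] XY[OF t] \<epsilon>M by linarith
    next
      show "\<bar>\<Psi> (Y T) - \<Psi> (X T)\<bar> \<le> e'"
        using d2(2)[of "Y T" "X T"] XY[of T] \<epsilon>M T by auto
    qed
    also have "\<dots> \<le> e" using \<epsilon>F e'_sum by linarith
    finally have "cost b f \<Psi> T x0 v \<le> cost b f \<Psi> T x0 u + e" by linarith
    with adm' show "\<exists>v Y. admissible_pair b U T x0 {0..T} v Y \<and> cost b f \<Psi> T x0 v \<le> cost b f \<Psi> T x0 u + e"
      by blast
  qed
qed

section \<open>Comparison of the optimal values\<close>

theorem theorem3p5:
  fixes T x0 :: real and U :: "real set"
    and b f :: "real \<Rightarrow> real \<Rightarrow> real" and \<Psi> :: "real \<Rightarrow> real"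
    and ubar Xbar :: "real \<Rightarrow> real"
    and utilde Xtilde :: "nat \<Rightarrow> (nat \<Rightarrow> real) \<Rightarrow> real \<Rightarrow> real"
  assumes T_pos: "0 < T"
    and U_conn: "connected U"
    and b_uc: "uniformly_continuous_on (UNIV \<times> U) (\<lambda>(x, u). b x u)"
    and f_uc: "uniformly_continuous_on (UNIV \<times> U) (\<lambda>(x, u). f x u)"
    and Psi_uc: "uniformly_continuous_on UNIV \<Psi>"
    and A1: "\<exists>c>0. \<forall>x1 x2. \<forall>u\<in>U. \<bar>b x1 u - b x2 u\<bar> \<le> c * \<bar>x1 - x2\<bar>"
    and A2: "\<exists>c>0. (SUP u\<in>controls U 0 T.
               (\<integral>\<^sup>+t. ennreal (\<bar>b 0 (u t)\<bar>\<^sup>2) \<partial>lebesgue_on {0..T})) \<le> ennreal c"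
    and A3_b: "\<forall>x. \<forall>u\<in>U. (\<lambda>y. b y u) differentiable (at x)"
              "continuous_on (UNIV \<times> U) (\<lambda>(x, u). deriv (\<lambda>y. b y u) x)"
    and A3_f: "\<forall>x. \<forall>u\<in>U. (\<lambda>y. f y u) differentiable (at x)"
              "continuous_on (UNIV \<times> U) (\<lambda>(x, u). deriv (\<lambda>y. f y u) x)"
    and A3_Psi: "\<forall>x. \<Psi> differentiable (at x)"
                "continuous_on UNIV (deriv \<Psi>)"
    and A4: "\<exists>c1>0. \<exists>c2>0. \<forall>x. \<forall>u1\<in>U. \<forall>u2\<in>U.
               c1 * \<bar>u1 - u2\<bar> \<le> \<bar>b x u1 - b x u2\<bar> \<and> \<bar>b x u1 - b x u2\<bar> \<le> c2 * \<bar>u1 - u2\<bar>"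
    and A5: "\<forall>t s. 0 \<le> t \<and> t \<le> s \<and> s \<le> T \<longrightarrow>
               (\<forall>u\<in>controls U 0 T. \<forall>y\<in>frontier state_set.
                  \<exists>u1\<in>controls U t s. \<exists>u2\<in>controls U t s. \<exists>X1 X2.
                    is_state b t s y u1 X1 \<and> is_state b t s y u2 X2 \<and> X1 s \<le> y \<and> y \<le> X2 s)"
    and opt: "optimal_pair_OCSC b f \<Psi> U T x0 ubar Xbar"
    and opt_discrete: "\<forall>n p. 0 < n \<and> is_partition T n p \<longrightarrow>
               optimal_pair_discrete b f \<Psi> U T x0 n p (utilde n p) (Xtilde n p)"
  shows "\<exists>\<Theta> :: real \<Rightarrow> real. (\<Theta> \<longlongrightarrow> 0) (at_right 0) \<and>
           (\<forall>\<delta>. 0 < \<delta> \<and> \<delta> < 1 \<longrightarrow>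
              (\<exists>n p. 0 < n \<and> is_partition T n p \<and>
                 \<bar>cost b f \<Psi> T x0 (utilde n p) - cost b f \<Psi> T x0 ubar\<bar> \<le> \<Theta> \<delta>))"
proof -
  have ubar: "ubar \<in> controls U 0 T" and Xbar: "is_state b 0 T x0 ubar Xbar"
    and Xbar_nonneg: "\<forall>t\<in>{0..T}. 0 \<le> Xbar t"
    and ubar_min: "\<And>v Y. admissible_pair b U T x0 {0..T} v Y \<Longrightarrow> cost b f \<Psi> T x0 ubar \<le> cost b f \<Psi> T x0 v"
    using opt by (auto simp: optimal_pair_OCSC_def optimal_pair_def admissible_pair_def state_set_def)
  obtain c where c: "0 < c" "\<And>x1 x2 u. u \<in> U \<Longrightarrow> \<bar>b x1 u - b x2 u\<bar> \<le> c * \<bar>x1 - x2\<bar>"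
    using A1 by blast
  obtain c1 c2 where c12: "0 < c1" "0 < c2"
    and c1: "\<And>x u1 u2. u1 \<in> U \<Longrightarrow> u2 \<in> U \<Longrightarrow> c1 * \<bar>u1 - u2\<bar> \<le> \<bar>b x u1 - b x u2\<bar>"
    and c2: "\<And>x u1 u2. u1 \<in> U \<Longrightarrow> u2 \<in> U \<Longrightarrow> \<bar>b x u1 - b x u2\<bar> \<le> c2 * \<bar>u1 - u2\<bar>"
    using A4 by blast
  obtain B where B: "\<And>u. u \<in> U \<Longrightarrow> \<bar>b 0 u\<bar> \<le> B"
    using abs_b0_bounded[of T b U, OF T_pos A2] by blast
  interpret control_system b U c B
    by standard (use c B uniformly_continuous_imp_continuous[OF b_uc] in auto)
  \<comment> \<open>(A4) at state 0 gives \<open>c1 * \<bar>u - u0\<bar> \<le> 2 * B\<close> for a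
    fixed \<open>u0\<close> in \<open>U\<close>.\<close>
  have U: "bounded U"
  proof -
    define u0 where "u0 = ubar 0"
    have u0: "u0 \<in> U" using ubar T_pos by (auto simp: u0_def controls_def)
    have "norm u \<le> \<bar>u0\<bar> + 2 * B / c1" if u: "u \<in> U" for u
    proof -
      have "c1 * \<bar>u - u0\<bar> \<le> 2 * B" using c1[OF u u0, of 0] B[OF u] B[OF u0] by linarith
      then have "\<bar>u - u0\<bar> \<le> 2 * B / c1" using c12 by (simp add: field_simps)
      then show ?thesis by simp
    qed
    then show ?thesis unfolding bounded_iff by blast
  qed
  have x0: "0 \<le> x0" using stateD(2)[OF ubar Xbar, of 0] Xbar_nonneg T_pos by force
  have main: "\<exists>n p. 0 < n \<and> is_partition T n p \<and>
      \<bar>cost b f \<Psi> T x0 (utilde n p) - cost b f \<Psi> T x0 ubar\<bar> \<le> \<delta>" if \<delta>: "0 < \<delta>" for \<delta>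
  proof -
    obtain n p where n: "0 < n" and p: "is_partition T n p"
      and near: "\<And>u X. admissible_pair b U T x0 (p ` {0..n}) u X
       \<Longrightarrow> \<exists>v Y. admissible_pair b U T x0 {0..T} v Y \<and> cost b f \<Psi> T x0 v \<le> cost b f \<Psi> T x0 u + \<delta>"
      using cost_almost_attained_by_feasible[OF T_pos U x0 \<delta> f_uc Psi_uc c12(1) c1 c2 c12(2)] by blast
    have opt_np: "optimal_pair b f \<Psi> U T x0 (p ` {0..n}) (utilde n p) (Xtilde n p)"
      using opt_discrete n p by (auto simp: optimal_pair_discrete_def)
    have p_mono: "p i \<le> p j" if "i \<le> j" "j \<le> n" for i j
      using that
    proof (induction j)
      case (Suc j)
      then have "p j < p (Suc j)" using p by (auto simp: is_partition_def)
      with Suc show ?case by (cases "i = Suc j") auto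
    qed auto
    have "p ` {0..n} \<subseteq> {0..T}"
      using p_mono[of 0] p_mono[of _ n] p by (auto simp: is_partition_def)
    \<comment> \<open>All partition points lie in \<open>[0,T]\<close>, so the OCSC optimum competes
      in the discrete problem.\<close>
    then have "admissible_pair b U T x0 (p ` {0..n}) ubar Xbar"
      using ubar Xbar Xbar_nonneg by (auto simp: admissible_pair_def state_set_def)
    then have "cost b f \<Psi> T x0 (utilde n p) \<le> cost b f \<Psi> T x0 ubar"
      using opt_np by (auto simp: optimal_pair_def)
    \<comment> \<open>Repair the discrete optimum and compare the repaired control with
      \<open>ubar\<close>.\<close>
    moreover have "cost b f \<Psi> T x0 ubar \<le> cost b f \<Psi> T x0 (utilde n p) + \<delta>"
      using near[of "utilde n p" "Xtilde n p"] opt_np ubar_min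
      by (force simp: optimal_pair_def)
    ultimately have "\<bar>cost b f \<Psi> T x0 (utilde n p) - cost b f \<Psi> T x0 ubar\<bar> \<le> \<delta>" by linarith
    with n p show ?thesis by blast
  qed
  \<comment> \<open>Every positive tolerance is attained by some partition, so the identity serves
    as \<open>\<Theta>\<close>.\<close>
  show ?thesis
    by (rule exI[of _ "\<lambda>\<delta>. \<delta>"]) (use main in \<open>auto intro: tendsto_ident_at\<close>)
qed

end
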